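(* Up to isomorphism there are exactly two diregular $(2,2,+2)$-digraphs, namely the digraphs $D_1$ and $D_2$ on the nine-element vertex set $\{u,u_1,u_2,u_4,u_5,u_6,v,v_1,v_4\}$ whose out-neighbourhoods are as follows. In $D_1$: $N^+(u)=\{u_1,u_2\}$, $N^+(u_1)=\{v_1,u_4\}$, $N^+(u_2)=\{u_5,u_6\}$, $N^+(v_1)=\{u,v_4\}$, $N^+(u_4)=\{u_5,v\}$, $N^+(u_5)=\{u_1,v_4\}$, $N^+(u_6)=\{u,u_4\}$, $N^+(v)=\{u_2,v_1\}$, $N^+(v_4)=\{u_6,v\}$. In $D_2$: $N^+(u)=\{u_1,u_2\}$, $N^+(u_1)=\{v,u_4\}$, $N^+(u_2)=\{u_5,u_6\}$, $N^+(v)=\{u_2,v_1\}$, $N^+(u_4)=\{u_5,u_6\}$, $N^+(u_5)=\{u,v_4\}$, $N^+(u_6)=\{u_1,v_1\}$, $N^+(v_1)=\{u,v_4\}$, $N^+(v_4)=\{v,u_4\}$. That is, $D_1$ and $D_2$ are diregular $(2,2,+2)$-digraphs, they are not isomorphic, and every diregular $(2,2,+2)$-digraph is isomorphic to $D_1$ or to $D_2$.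
   Context: All digraphs are finite. $N^+(x)=\{y : x\to y\}$ denotes the out-neighbourhood of a vertex $x$. A digraph is $k$-geodetic if for all vertices $x,y$ (possibly equal) there is at most one directed walk of length at most $k$ from $x$ to $y$, where for $x=y$ the trivial walk of length $0$ is counted (so there are no loops, no multiple arcs, and no directed cycles of length at most $k$). Let $M(2,k)=1+2+2^2+\dots+2^k$. A $(2,k,+2)$-digraph is a $k$-geodetic digraph in which every vertex has out-degree at least $2$ and which has exactly $M(2,k)+2$ vertices; thus a $(2,2,+2)$-digraph has $9$ vertices. Such a digraph is called diregular if every vertex has in-degree and out-degree equal to $2$. *)

theory Defs
  imports "Graph_Theory.Digraph_Isomorphism" "Graph_Theory.Pair_Digraph"
begin

text \<open>
  Walks are lists of arcs, so two parallel arcs count as two different walks of length 1.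
  Hence loops and parallel arcs, which \<^const>\<open>fin_digraph\<close> permits, are excluded
  by \<open>k_geodetic\<close> for \<open>k \<ge> 1\<close>, and need no separate assumption.
\<close>

definition k_geodetic :: "nat \<Rightarrow> ('a, 'b) pre_digraph \<Rightarrow> bool" where
  "k_geodetic k G \<longleftrightarrow>
    (\<forall>x\<in>verts G. \<forall>y\<in>verts G. \<forall>p q.
      pre_digraph.awalk G x p y \<and> length p \<le> k \<longrightarrow>
      pre_digraph.awalk G x q y \<and> length q \<le> k \<longrightarrow> p = q)"

definition moore_bound :: "nat \<Rightarrow> nat \<Rightarrow> nat" where
  "moore_bound d k = (\<Sum>i\<le>k. d ^ i)"

text \<open>\<open>excess_digraph d k e G\<close> says that \<open>G\<close> is a \<open>(d,k,+e)\<close>-digraph.\<close>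

definition excess_digraph :: "nat \<Rightarrow> nat \<Rightarrow> nat \<Rightarrow> ('a, 'b) pre_digraph \<Rightarrow> bool" where
  "excess_digraph d k e G \<longleftrightarrow>
    fin_digraph G \<and> k_geodetic k G \<and>
    (\<forall>x\<in>verts G. d \<le> out_degree G x) \<and>
    card (verts G) = moore_bound d k + e"

definition diregular :: "nat \<Rightarrow> ('a, 'b) pre_digraph \<Rightarrow> bool" where
  "diregular d G \<longleftrightarrow> (\<forall>x\<in>verts G. in_degree G x = d \<and> out_degree G x = d)"

definition digraph_of_nbhds :: "('a \<Rightarrow> 'a set) \<Rightarrow> ('a, 'a \<times> 'a) pre_digraph" where
  "digraph_of_nbhds N = with_proj \<lparr>pverts = UNIV, parcs = {(x, y). y \<in> N x}\<rparr>"

datatype vertex = U | U1 | U2 | U4 | U5 | U6 | V | V1 | V4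

fun N1 :: "vertex \<Rightarrow> vertex set" where
  "N1 U  = {U1, U2}"
| "N1 U1 = {V1, U4}"
| "N1 U2 = {U5, U6}"
| "N1 V1 = {U, V4}"
| "N1 U4 = {U5, V}"
| "N1 U5 = {U1, V4}"
| "N1 U6 = {U, U4}"
| "N1 V  = {U2, V1}"
| "N1 V4 = {U6, V}"

fun N2 :: "vertex \<Rightarrow> vertex set" where
  "N2 U  = {U1, U2}"
| "N2 U1 = {V, U4}"
| "N2 U2 = {U5, U6}"
| "N2 V  = {U2, V1}"
| "N2 U4 = {U5, U6}"
| "N2 U5 = {U, V4}"
| "N2 U6 = {U1, V1}"
| "N2 V1 = {U, V4}"
| "N2 V4 = {V, U4}"

definition D1 :: "(vertex, vertex \<times> vertex) pre_digraph" where
  "D1 = digraph_of_nbhds N1"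

definition D2 :: "(vertex, vertex \<times> vertex) pre_digraph" where
  "D2 = digraph_of_nbhds N2"

end

theory Submission
  imports Defs
begin

text \<open>
  Being \<open>2\<close>-geodetic means that the vertices \<open>u\<close>, \<open>N\<^sup>+(u)\<close> and \<open>N\<^sup>+(N\<^sup>+(u))\<close> of the tree of
  walks of length at most 2 from any \<open>u\<close> are seven distinct vertices, so exactly two vertices are
  missed by it. Labelling the tree at one vertex leaves six unknown out-neighbourhoods. A
  backtracking search, pruned by distinctness of the other trees and by in-degrees, finds all ways to
  fill them in; for each of the 96 solutions it also finds an isomorphism from \<open>D1\<close> or \<open>D2\<close>. The two are told
  apart by the vertices \<open>U2\<close> and \<open>U4\<close> of \<open>D2\<close>, which have the same out-neighbourhood.
\<close>

section \<open>Two-geodetic neighbourhood functions\<close>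

text \<open>Parallel arcs collapse here, so the arcs are recovered from \<open>out_nbhd\<close> only
  when \<open>arc_to_ends\<close> is injective on them.\<close>

definition out_nbhd :: "('a, 'b) pre_digraph \<Rightarrow> 'a \<Rightarrow> 'a set" where
  "out_nbhd G x = {y. (x, y) \<in> arcs_ends G}"

text \<open>The conjuncts exclude 2-cycles, an arc beside a 2-walk with the same ends, and two
  2-walks with the same ends. At \<open>y = x\<close> the first excludes loops.\<close>

definition two_geodetic :: "('a \<Rightarrow> 'a set) \<Rightarrow> bool" where
  "two_geodetic N \<longleftrightarrow> (\<forall>x. \<forall>y\<in>N x. x \<notin> N y \<and> N x \<inter> N y = {} \<and>
    (\<forall>z\<in>N x. y \<noteq> z \<longrightarrow> N y \<inter> N z = {}))"

lemma two_geodetic_irrefl: "two_geodetic N \<Longrightarrow> x \<notin> N x"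
  unfolding two_geodetic_def by blast

lemma two_geodetic_vimage:
  assumes "inj f" "two_geodetic N"
  shows "two_geodetic (\<lambda>x. f -` N (f x))"
  unfolding two_geodetic_def
proof (intro allI ballI)
  fix x y
  assume "y \<in> f -` N (f x)"
  then have "f x \<notin> N (f y) \<and> N (f x) \<inter> N (f y) = {} \<and> (\<forall>z\<in>N (f x). f y \<noteq> z \<longrightarrow> N (f y) \<inter> N z = {})"
    using assms(2) unfolding two_geodetic_def by blast
  then show "x \<notin> f -` N (f y) \<and> f -` N (f x) \<inter> f -` N (f y) = {} \<and>
      (\<forall>z\<in>f -` N (f x). y \<noteq> z \<longrightarrow> f -` N (f y) \<inter> f -` N (f z) = {})"
    using injD[OF assms(1)] by blast
qed

section \<open>Walks of length at most two and degrees in terms of out-neighbourhoods\<close>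

lemma length_le_2_cases:
  assumes "length xs \<le> 2"
  obtains "xs = []" | a where "xs = [a]" | a b where "xs = [a, b]"
  using assms by (cases xs; cases "tl xs") auto

context wf_digraph
begin

text \<open>Each forbidden configuration gives two different walks of length at most 2 with the same
  ends; for a 2-cycle the second is the empty walk.\<close>

lemma k_geodetic_2_imp:
  assumes "k_geodetic 2 G"
  shows "inj_on (arc_to_ends G) (arcs G)" and "two_geodetic (out_nbhd G)"
proof -
  have eq: "p = q" if "awalk x p y" "awalk x q y" "length p \<le> 2" "length q \<le> 2" for x y p q
    using assms that unfolding k_geodetic_def by (meson awalkE')
  have walk1: "awalk (tail G e) [e] (head G e)" if "e \<in> arcs G" for e
    using that by (simp add: awalk_simps)
  have walk2: "awalk (tail G e) [e, f] (head G f)" if "e \<in> arcs G" "f \<in> arcs G" "head G e = tail G f" for e f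
    using that by (simp add: awalk_simps)
  show "inj_on (arc_to_ends G) (arcs G)"
  proof (rule inj_onI)
    fix e f assume "e \<in> arcs G" "f \<in> arcs G" "arc_to_ends G e = arc_to_ends G f"
    then show "e = f"
      using eq[OF walk1[of e], of "[f]"] walk1[of f] by (simp add: arc_to_ends_def)
  qed
  show "two_geodetic (out_nbhd G)"
    unfolding two_geodetic_def
  proof (intro allI ballI conjI impI)
    fix x y assume "y \<in> out_nbhd G x"
    then obtain e where e: "e \<in> arcs G" "tail G e = x" "head G e = y"
      by (auto simp: out_nbhd_def)
    show "x \<notin> out_nbhd G y"
    proof
      assume "x \<in> out_nbhd G y"
      then obtain f where f: "f \<in> arcs G" "tail G f = y" "head G f = x"
        by (auto simp: out_nbhd_def)
      then show False
        using eq[OF walk2[of e f], of "[]"] e by (auto simp: awalk_simps)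
    qed
    show "out_nbhd G x \<inter> out_nbhd G y = {}"
    proof (rule ccontr)
      assume "out_nbhd G x \<inter> out_nbhd G y \<noteq> {}"
      then obtain z f g where "f \<in> arcs G" "tail G f = x" "head G f = z"
          "g \<in> arcs G" "tail G g = y" "head G g = z"
        by (auto simp: out_nbhd_def elim!: reachableE)
      then show False
        using eq[OF walk2[of e g], of "[f]"] walk1[of f] e by auto
    qed
    fix z assume "z \<in> out_nbhd G x" "y \<noteq> z"
    then obtain f where f: "f \<in> arcs G" "tail G f = x" "head G f = z"
      by (auto simp: out_nbhd_def)
    show "out_nbhd G y \<inter> out_nbhd G z = {}"
    proof (rule ccontr)
      assume "out_nbhd G y \<inter> out_nbhd G z \<noteq> {}"
      then obtain w g h where "g \<in> arcs G" "tail G g = y" "head G g = w"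
          "h \<in> arcs G" "tail G h = z" "head G h = w"
        by (auto simp: out_nbhd_def elim!: reachableE)
      then show False
        using eq[OF walk2[of e g], of "[f, h]"] walk2[of f h] e f \<open>y \<noteq> z\<close> by auto
    qed
  qed
qed

lemma k_geodetic_2I:
  assumes inj: "inj_on (arc_to_ends G) (arcs G)" and geo: "two_geodetic (out_nbhd G)"
  shows "k_geodetic 2 G"
  unfolding k_geodetic_def
proof (intro ballI allI impI)
  fix x y p q
  assume p: "awalk x p y \<and> length p \<le> 2" and q: "awalk x q y \<and> length q \<le> 2"
  have out: "head G e \<in> out_nbhd G (tail G e)" if "e \<in> arcs G" for e
    using that by (auto simp: out_nbhd_def arcs_ends_conv)
  have par: "e = f" if "e \<in> arcs G" "f \<in> arcs G" "tail G e = tail G f" "head G e = head G f" for e f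
    using inj_onD[OF inj _ that(1,2)] that by (simp add: arc_to_ends_def)
  have loop: False if "e \<in> arcs G" "tail G e = head G e" for e
    using out[OF that(1)] two_geodetic_irrefl[OF geo] that(2) by simp
  have cycle: False if "e \<in> arcs G" "f \<in> arcs G" "head G e = tail G f" "tail G e = head G f" for e f
    using geo out[OF that(1)] out[OF that(2)] that(3,4) unfolding two_geodetic_def by auto
  have shortcut: False if "e \<in> arcs G" "f \<in> arcs G" "g \<in> arcs G" "head G e = tail G f"
      "tail G g = tail G e" "head G g = head G f" for e f g
  proof -
    have "out_nbhd G (tail G e) \<inter> out_nbhd G (head G e) = {}"
      using geo out[OF that(1)] unfolding two_geodetic_def by blast
    then show False
      using out[OF that(2)] out[OF that(3)] that(4-6) by auto
  qed
  have double: "e = e' \<and> f = f'" if "e \<in> arcs G" "f \<in> arcs G" "e' \<in> arcs G" "f' \<in> arcs G"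
      "head G e = tail G f" "head G e' = tail G f'" "tail G e = tail G e'" "head G f = head G f'" for e f e' f'
  proof -
    have "head G e = head G e'"
    proof (rule ccontr)
      assume "head G e \<noteq> head G e'"
      then have "out_nbhd G (head G e) \<inter> out_nbhd G (head G e') = {}"
        using geo out[OF that(1)] out[OF that(3)] that(7) unfolding two_geodetic_def by auto
      then show False
        using out[OF that(2)] out[OF that(4)] that(5,6,8) by auto
    qed
    then show ?thesis
      using that by (auto intro: par)
  qed
  show "p = q"
    \<comment> \<open>Split by the two lengths: \<open>loop\<close> settles 0 against 1,
      \<open>cycle\<close> 0 against 2, \<open>par\<close> 1 against 1, \<open>shortcut\<close> 1
      against 2 and \<open>double\<close> 2 against 2.\<close>
    using conjunct2[OF p] conjunct2[OF q] conjunct1[OF p] conjunct1[OF q]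
    by (elim length_le_2_cases)
      (simp_all add: awalk_simps; metis par loop cycle shortcut double)+
qed

lemma out_degree_eq_card_out_nbhd:
  assumes "inj_on (arc_to_ends G) (arcs G)"
  shows "out_degree G x = card (out_nbhd G x)"
proof -
  have "out_nbhd G x = head G ` out_arcs G x"
    by (auto simp: out_nbhd_def arcs_ends_conv)
  moreover have "inj_on (head G) (out_arcs G x)"
    using assms by (auto simp: inj_on_def arc_to_ends_def)
  ultimately show ?thesis
    by (simp add: out_degree_def card_image)
qed

lemma in_degree_eq_card_in_nbhd:
  assumes "inj_on (arc_to_ends G) (arcs G)"
  shows "in_degree G y = card {x. y \<in> out_nbhd G x}"
proof -
  have "{x. y \<in> out_nbhd G x} = tail G ` in_arcs G y"
    by (auto simp: out_nbhd_def arcs_ends_conv)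
  moreover have "inj_on (tail G) (in_arcs G y)"
    using assms by (auto simp: inj_on_def arc_to_ends_def)
  ultimately show ?thesis
    by (simp add: in_degree_def card_image)
qed

lemma digraph_iso_digraph_of_nbhdsI:
  assumes inj: "inj_on (arc_to_ends G) (arcs G)"
    and bij: "bij_betw \<theta> UNIV (verts G)"
    and nbhd: "\<And>x y. \<theta> y \<in> out_nbhd G (\<theta> x) \<longleftrightarrow> y \<in> N x"
  shows "digraph_iso G (digraph_of_nbhds N)"
proof -
  define \<phi> where "\<phi> = inv_into UNIV \<theta>"
  have \<phi>\<theta>: "\<phi> (\<theta> x) = x" for x
    using bij by (simp add: \<phi>_def bij_betw_def)
  have \<theta>\<phi>: "\<theta> (\<phi> x) = x" if "x \<in> verts G" for x
    using bij that by (simp add: \<phi>_def bij_betw_def f_inv_into_f)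
  \<comment> \<open>The isomorphism runs from \<open>G\<close> to the labels, against
    \<open>\<theta>\<close>; an arc becomes the pair of the labels of its ends, injectively since no
    arcs are parallel.\<close>
  define hom where "hom = \<lparr>iso_verts = \<phi>, iso_arcs = (\<lambda>e. (\<phi> (tail G e), \<phi> (head G e))),
    iso_head = snd, iso_tail = fst\<rparr>"
  have "inj_on \<phi> (verts G)"
    by (metis \<theta>\<phi> inj_on_inverseI)
  moreover have "inj_on (iso_arcs hom) (arcs G)"
  proof (rule inj_onI)
    fix e f assume "e \<in> arcs G" "f \<in> arcs G" "iso_arcs hom e = iso_arcs hom f"
    moreover from this have "tail G e = tail G f" "head G e = head G f"
      unfolding hom_def by (auto dest!: arg_cong[where f = \<theta>] simp: \<theta>\<phi>)
    ultimately show "e = f"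
      using inj by (auto simp: inj_on_def arc_to_ends_def)
  qed
  ultimately have hom: "digraph_isomorphism hom"
    unfolding digraph_isomorphism_def by (simp add: hom_def wf_digraph)
  have verts: "\<phi> ` verts G = UNIV"
  proof -
    have "verts G = range \<theta>"
      using bij by (simp add: bij_betw_def)
    then show ?thesis
      by (simp add: image_image \<phi>\<theta>)
  qed
  have arcs: "(\<lambda>e. (\<phi> (tail G e), \<phi> (head G e))) ` arcs G = {(x, y). y \<in> N x}"
  proof (intro equalityI subsetI)
    fix a assume "a \<in> (\<lambda>e. (\<phi> (tail G e), \<phi> (head G e))) ` arcs G"
    then obtain e where e: "e \<in> arcs G" "a = (\<phi> (tail G e), \<phi> (head G e))"
      by blast
    then have "head G e \<in> out_nbhd G (tail G e)"
      by (auto simp: out_nbhd_def arcs_ends_conv)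
    then show "a \<in> {(x, y). y \<in> N x}"
      using e nbhd[of "\<phi> (head G e)" "\<phi> (tail G e)"] by (simp add: \<theta>\<phi>)
  next
    fix a assume "a \<in> {(x, y). y \<in> N x}"
    then obtain x y where "a = (x, y)" "\<theta> y \<in> out_nbhd G (\<theta> x)"
      using nbhd by blast
    then obtain e where "a = (x, y)" "e \<in> arcs G" "tail G e = \<theta> x" "head G e = \<theta> y"
      by (auto simp: out_nbhd_def)
    then show "a \<in> (\<lambda>e. (\<phi> (tail G e), \<phi> (head G e))) ` arcs G"
      by (auto simp: \<phi>\<theta> intro!: rev_image_eqI)
  qed
  \<comment> \<open>\<open>digraph_iso\<close> demands equality with the image digraph, including
    its tail and head maps; hence \<open>fst\<close> and \<open>snd\<close> in
    \<open>hom\<close>.\<close>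
  have "digraph_of_nbhds N = app_iso hom G"
    by (simp add: digraph_of_nbhds_def with_proj_def app_iso_def hom_def verts arcs)
  then show ?thesis
    using hom unfolding digraph_iso_def by blast
qed

end


section \<open>Digraphs on the nine labels\<close>

definition all_vertices :: "vertex list" where
  "all_vertices = [U, U1, U2, U4, U5, U6, V, V1, V4]"

lemma UNIV_vertex: "UNIV = set all_vertices"
  using vertex.exhaust by (auto simp: all_vertices_def)

lemma distinct_all_vertices: "distinct all_vertices"
  by (simp add: all_vertices_def)

instance vertex :: finite
  by standard (simp add: UNIV_vertex)

lemma card_vertex: "card (UNIV :: vertex set) = 9"
  unfolding UNIV_vertex distinct_card[OF distinct_all_vertices] by (simp add: all_vertices_def)

text \<open>Makes in-degrees computable by simplification.\<close>

lemma card_Collect_vertex: "card {x. P x} = length (filter P all_vertices)"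
proof -
  have "{x. P x} = set (filter P all_vertices)"
    using UNIV_vertex by auto
  then show ?thesis
    using distinct_all_vertices by (metis distinct_card distinct_filter)
qed

lemma out_nbhd_digraph_of_nbhds [simp]: "out_nbhd (digraph_of_nbhds N) = N"
  by (auto simp: out_nbhd_def digraph_of_nbhds_def)

lemma digraph_of_nbhds_diregular_excess:
  fixes N :: "vertex \<Rightarrow> vertex set"
  assumes geo: "two_geodetic N" and out: "\<And>x. card (N x) = 2" and in_nbhd: "\<And>y. card {x. y \<in> N x} = 2"
  shows "excess_digraph 2 2 2 (digraph_of_nbhds N) \<and> diregular 2 (digraph_of_nbhds N)"
proof -
  interpret fin_digraph "digraph_of_nbhds N"
    by standard (auto simp: digraph_of_nbhds_def)
  have inj: "inj_on (arc_to_ends (digraph_of_nbhds N)) (arcs (digraph_of_nbhds N))"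
    by (auto simp: inj_on_def arc_to_ends_def digraph_of_nbhds_def)
  have "k_geodetic 2 (digraph_of_nbhds N)"
    using inj geo by (intro k_geodetic_2I) simp_all
  moreover have "card (verts (digraph_of_nbhds N)) = moore_bound 2 2 + 2"
    by (simp add: digraph_of_nbhds_def card_vertex moore_bound_def numeral_2_eq_2)
  ultimately show ?thesis
    by (simp add: excess_digraph_def diregular_def out_degree_eq_card_out_nbhd[OF inj]
        in_degree_eq_card_in_nbhd[OF inj] out in_nbhd fin_digraph)
qed

section \<open>The two examples and their non-isomorphism\<close>

lemma D1_diregular_excess: "excess_digraph 2 2 2 D1 \<and> diregular 2 D1"
  unfolding D1_def
proof (rule digraph_of_nbhds_diregular_excess)
  show "two_geodetic N1"
    unfolding two_geodetic_def
  proof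
    fix x show "\<forall>y\<in>N1 x. x \<notin> N1 y \<and> N1 x \<inter> N1 y = {} \<and> (\<forall>z\<in>N1 x. y \<noteq> z \<longrightarrow> N1 y \<inter> N1 z = {})"
      by (cases x) simp_all
  qed
  show "card (N1 x) = 2" for x
    by (cases x) simp_all
  show "card {x. y \<in> N1 x} = 2" for y
    by (cases y) (simp_all add: card_Collect_vertex all_vertices_def)
qed

lemma D2_diregular_excess: "excess_digraph 2 2 2 D2 \<and> diregular 2 D2"
  unfolding D2_def
proof (rule digraph_of_nbhds_diregular_excess)
  show "two_geodetic N2"
    unfolding two_geodetic_def
  proof
    fix x show "\<forall>y\<in>N2 x. x \<notin> N2 y \<and> N2 x \<inter> N2 y = {} \<and> (\<forall>z\<in>N2 x. y \<noteq> z \<longrightarrow> N2 y \<inter> N2 z = {})"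
      by (cases x) simp_all
  qed
  show "card (N2 x) = 2" for x
    by (cases x) simp_all
  show "card {x. y \<in> N2 x} = 2" for y
    by (cases y) (simp_all add: card_Collect_vertex all_vertices_def)
qed

text \<open>The separating invariant: \<open>N2\<close> takes the same value at \<open>U2\<close>
  and \<open>U4\<close>, and an isomorphism would carry this coincidence back to
  \<open>N1\<close>.\<close>

lemma inj_N1: "inj N1"
proof (rule injI)
  fix x y assume "N1 x = N1 y"
  then show "x = y"
    by (cases x; cases y) (simp_all add: doubleton_eq_iff)
qed

lemma D1_not_iso_D2: "\<not> digraph_iso D1 D2"
proof
  assume "digraph_iso D1 D2"
  then obtain h where h: "pre_digraph.digraph_isomorphism D1 h" and D2: "D2 = app_iso h D1"
    by (auto simp: digraph_iso_def)
  interpret D1: wf_digraph D1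
    using h by (simp add: pre_digraph.digraph_isomorphism_def)
  define g where "g = iso_verts h"
  have "inj g"
    using h by (simp add: pre_digraph.digraph_isomorphism_def g_def D1_def digraph_of_nbhds_def)
  have "verts D2 = g ` verts D1"
    unfolding D2 by (simp add: g_def)
  then have "surj g"
    by (simp add: D1_def D2_def digraph_of_nbhds_def)
  have ends: "arcs_ends D2 = (\<lambda>(u, v). (g u, g v)) ` arcs_ends D1"
    unfolding D2 g_def by (rule D1.arcs_ends_app_iso_eq[OF h])
  have N2: "N2 (g x) = g ` N1 x" for x
  proof -
    have "N2 (g x) = out_nbhd D2 (g x)"
      by (simp add: D2_def)
    also have "\<dots> = g ` out_nbhd D1 x"
      using \<open>inj g\<close> by (auto simp: out_nbhd_def ends dest: injD)
    finally show ?thesis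
      by (simp add: D1_def)
  qed
  obtain x y where "g x = U2" "g y = U4"
    using \<open>surj g\<close> by (metis surjD)
  then have "g ` N1 x = g ` N1 y"
    using N2[of x] N2[of y] by simp
  then have "x = y"
    using \<open>inj g\<close> inj_N1 by (metis inj_image_eq_iff injD)
  then show False
    using \<open>g x = U2\<close> \<open>g y = U4\<close> by simp
qed


section \<open>An exhaustive search\<close>

text \<open>
  A partial digraph is a list of entries \<open>(x, a, b)\<close>, each saying that the
  out-neighbourhood of \<open>x\<close> is \<open>{a, b}\<close>.
\<close>

type_synonym entry = "vertex \<times> vertex \<times> vertex"

definition agrees :: "(vertex \<Rightarrow> vertex set) \<Rightarrow> entry list \<Rightarrow> bool" where
  "agrees N es \<longleftrightarrow> (\<forall>(x, a, b)\<in>set es. N x = {a, b})"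

lemma agrees_map_of: "agrees N es \<Longrightarrow> map_of es x = Some (a, b) \<Longrightarrow> N x = {a, b}"
  by (auto simp: agrees_def dest!: map_of_SomeD)

section \<open>Matching a list of entries with the templates\<close>

definition assign :: "vertex \<Rightarrow> vertex \<Rightarrow> (vertex \<Rightarrow> vertex option) \<Rightarrow> (vertex \<Rightarrow> vertex option) option" where
  "assign a c m = (case m a of None \<Rightarrow> Some (m(a := Some c)) | Some d \<Rightarrow> if c = d then Some m else None)"

text \<open>Extends \<open>m\<close>, a partial map from template labels to labels of
  \<open>es\<close>, trying both orders of each out-neighbourhood. Injectivity is left to the final
  surjectivity test, which on a finite type amounts to bijectivity.\<close>

fun embeds :: "entry list \<Rightarrow> entry list \<Rightarrow> (vertex \<Rightarrow> vertex option) \<Rightarrow> bool" where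
  "embeds es [] m \<longleftrightarrow> list_all (\<lambda>y. list_ex (\<lambda>x. m x = Some y) all_vertices) all_vertices"
| "embeds es ((x, a, b) # ts) m \<longleftrightarrow>
    (case Option.bind (m x) (map_of es) of
      None \<Rightarrow> False
    | Some (c, d) \<Rightarrow> list_ex
        (\<lambda>(c, d). case Option.bind (assign a c m) (assign b d) of
          None \<Rightarrow> False | Some m' \<Rightarrow> embeds es ts m') [(c, d), (d, c)])"

lemma assign_SomeD: "assign a c m = Some m' \<Longrightarrow> m \<subseteq>\<^sub>m m' \<and> m' a = Some c"
  by (auto simp: assign_def map_le_def split: option.splits if_splits)

text \<open>Assignments only grow, so the total map obtained for the remaining entries keeps the
  values chosen at the present one.\<close>

lemma embeds_sound:
  assumes "embeds es ts m" "agrees N es"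
  shows "\<exists>f. m \<subseteq>\<^sub>m Some \<circ> f \<and> surj f \<and> (\<forall>(x, a, b)\<in>set ts. N (f x) = {f a, f b})"
  using assms
proof (induction es ts m rule: embeds.induct)
  case (1 es m)
  have "\<exists>x. m x = Some y" for y
    using 1 UNIV_vertex by (auto simp: list_all_iff list_ex_iff)
  then have "surj (the \<circ> m)"
    unfolding surj_def comp_def by (metis option.sel)
  \<comment> \<open>Outside the domain of \<open>m\<close> the value of \<open>the\<close> is
    arbitrary, but the map order compares on that domain only.\<close>
  moreover have "m \<subseteq>\<^sub>m Some \<circ> (the \<circ> m)"
    by (auto simp: map_le_def)
  ultimately show ?case
    by (intro exI[of _ "the \<circ> m"]) (simp add: comp_def)
next
  case (2 es x a b ts m)
  then obtain y c d where y: "m x = Some y" "map_of es y = Some (c, d)"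
    by (auto split: option.splits simp: bind_eq_Some_conv)
  have "\<exists>p q m1 m2. (p, q) \<in> set [(c, d), (d, c)] \<and> assign a p m = Some m1 \<and> assign b q m1 = Some m2
      \<and> embeds es ts m2"
    using 2(2) y by (auto split: option.splits simp: bind_eq_Some_conv)
  then obtain p q m1 m2 where pq: "(p, q) \<in> set [(c, d), (d, c)]"
    and m: "assign a p m = Some m1" "assign b q m1 = Some m2" "embeds es ts m2"
    by blast
  have "\<exists>f. m2 \<subseteq>\<^sub>m Some \<circ> f \<and> surj f \<and> (\<forall>(x, a, b)\<in>set ts. N (f x) = {f a, f b})"
    by (rule "2.IH"[of "(c, d)" c d "(p, q)" p q m2]) (use y pq m 2 in \<open>auto simp: bind_eq_Some_conv\<close>)
  then obtain f where f: "m2 \<subseteq>\<^sub>m Some \<circ> f" "surj f" "\<forall>(x, a, b)\<in>set ts. N (f x) = {f a, f b}"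
    by blast
  have le: "m \<subseteq>\<^sub>m m1" "m1 \<subseteq>\<^sub>m m2" and ab: "m1 a = Some p" "m2 b = Some q"
    using m by (auto dest: assign_SomeD)
  have val: "f z = w" if "m' z = Some w" "m' \<subseteq>\<^sub>m m2" for m' z w
    using map_le_trans[OF that(2) f(1)] that(1) by (force simp: map_le_def)
  have "f a = p" "f b = q" "f x = y"
    using val[of m1 a p] val[of m2 b q] val[of m x y] ab y(1) le map_le_trans[OF le] by simp_all
  moreover have "N y = {c, d}"
    using agrees_map_of y(2) 2(3) by blast
  ultimately have "N (f x) = {f a, f b}"
    using pq by auto
  then show ?case
    using f map_le_trans[OF map_le_trans[OF le] f(1)]
    by (intro exI[of _ f]) (simp add: comp_def)
qed

text \<open>
  The templates list \<open>N1\<close> and \<open>N2\<close> in an order in which each vertex occurs as an out-neighbour before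
  its own entry (\<open>U\<close> apart), so that \<open>embeds\<close> always knows the image of the vertex it expands.
\<close>

definition template1 :: "entry list" where
  "template1 = [(U, U1, U2), (U1, V1, U4), (U2, U5, U6), (V1, U, V4), (U4, U5, V),
    (U5, U1, V4), (U6, U, U4), (V, U2, V1), (V4, U6, V)]"

definition template2 :: "entry list" where
  "template2 = [(U, U1, U2), (U1, V, U4), (U2, U5, U6), (V, U2, V1), (U4, U5, U6),
    (U5, U, V4), (U6, U1, V1), (V1, U, V4), (V4, V, U4)]"

text \<open>Only the image \<open>r\<close> of \<open>U\<close> is guessed freely; all other images
  come from expanding entries.\<close>

definition classified :: "entry list \<Rightarrow> bool" where
  "classified es \<longleftrightarrow> list_ex (\<lambda>r. embeds es template1 [U \<mapsto> r]) all_vertices \<or>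
    list_ex (\<lambda>r. embeds es template2 [U \<mapsto> r]) all_vertices"

text \<open>Here \<open>f\<close> is an isomorphism from the digraph of \<open>M\<close> to that of
  \<open>N\<close>.\<close>

definition relabels :: "(vertex \<Rightarrow> vertex set) \<Rightarrow> (vertex \<Rightarrow> vertex set) \<Rightarrow> bool" where
  "relabels N M \<longleftrightarrow> (\<exists>f. bij f \<and> (\<forall>x. N (f x) = f ` M x))"

lemma embeds_imp_relabels:
  assumes "embeds es ts m" "agrees N es" "agrees M ts" "UNIV = fst ` set ts"
  shows "relabels N M"
proof -
  obtain f where f: "surj f" "\<forall>(x, a, b)\<in>set ts. N (f x) = {f a, f b}"
    using embeds_sound[OF assms(1,2)] by blast
  have "N (f x) = f ` M x" for x
  proof -
    obtain a b where "(x, a, b) \<in> set ts"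
      using assms(4) by force
    then show ?thesis
      using f(2) assms(3) by (fastforce simp: agrees_def)
  qed
  then show ?thesis
    using f(1) finite_UNIV_surj_inj[of f] by (auto simp: relabels_def bij_def)
qed

lemma classified_imp_relabels:
  assumes "classified es" "agrees N es"
  shows "relabels N N1 \<or> relabels N N2"
proof -
  have "agrees N1 template1" "UNIV = fst ` set template1"
      "agrees N2 template2" "UNIV = fst ` set template2"
    by (auto simp: agrees_def template1_def template2_def UNIV_vertex all_vertices_def)
  then show ?thesis
    using assms by (auto simp: classified_def list_ex_iff dest: embeds_imp_relabels)
qed

section \<open>Candidate out-neighbourhoods and pruning tests\<close>

fun pairs :: "'a list \<Rightarrow> ('a \<times> 'a) list" where
  "pairs [] = []"
| "pairs (x # xs) = map (Pair x) xs @ pairs xs"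

lemma pairs_cover: "a \<in> set xs \<Longrightarrow> b \<in> set xs \<Longrightarrow> a \<noteq> b \<Longrightarrow> (a, b) \<in> set (pairs xs) \<or> (b, a) \<in> set (pairs xs)"
  by (induction xs) auto

definition known_nbhd :: "entry list \<Rightarrow> vertex \<Rightarrow> vertex list" where
  "known_nbhd es x = (case map_of es x of None \<Rightarrow> [] | Some (a, b) \<Rightarrow> [a, b])"

text \<open>The part known so far of the tree of walks of length at most 2 from \<open>x\<close>;
  unassigned vertices contribute no leaves.\<close>

definition known_tree :: "entry list \<Rightarrow> entry \<Rightarrow> vertex list" where
  "known_tree es = (\<lambda>(x, a, b). x # a # b # known_nbhd es a @ known_nbhd es b)"

definition saturated :: "entry list \<Rightarrow> vertex \<Rightarrow> bool" where
  "saturated es y \<longleftrightarrow> 2 \<le> length (filter (\<lambda>(x, a, b). a = y \<or> b = y) es)"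

text \<open>A new entry at \<open>x\<close> affects only the trees having \<open>x\<close> as root
  or as child of the root, so only those are tested again.\<close>

definition admissible :: "entry list \<Rightarrow> vertex \<Rightarrow> bool" where
  "admissible es x \<longleftrightarrow>
    list_all (\<lambda>e. distinct (known_tree es e)) (filter (\<lambda>(y, a, b). y = x \<or> a = x \<or> b = x) es)"

text \<open>
  Here \<open>if\<close> rather than \<open>\<longrightarrow>\<close>, because the simplifier delays the evaluation of its
  branches: the recursive call of a rejected candidate is never expanded.
\<close>

fun search :: "vertex list \<Rightarrow> entry list \<Rightarrow> bool" where
  "search [] es \<longleftrightarrow> classified es"
| "search (x # xs) es \<longleftrightarrow>
    list_all (\<lambda>(a, b). let es' = (x, a, b) # es in if admissible es' x then search xs es' else True)
      (pairs (filter (\<lambda>y. \<not> saturated es y) all_vertices))"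

section \<open>Soundness of the search\<close>

locale two_geodetic_labelling =
  fixes N :: "vertex \<Rightarrow> vertex set"
  assumes geo: "two_geodetic N"
    and out: "card (N x) = 2"
    and in_nbhd: "card {x. y \<in> N x} \<le> 2"
begin

lemma known_nbhd:
  assumes "agrees N es"
  shows "set (known_nbhd es x) \<subseteq> N x" and "distinct (known_nbhd es x)"
proof (atomize (full), cases "map_of es x")
  case (Some p)
  then obtain a b where ab: "map_of es x = Some (a, b)"
    by (cases p) simp
  then have "N x = {a, b}"
    by (rule agrees_map_of[OF assms])
  moreover from this have "a \<noteq> b"
    using out[of x] by auto
  ultimately show "set (known_nbhd es x) \<subseteq> N x \<and> distinct (known_nbhd es x)"
    using ab by (simp add: known_nbhd_def)
qed (simp add: known_nbhd_def)

lemma distinct_known_tree: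
  assumes "agrees N es" "e \<in> set es"
  shows "distinct (known_tree es e)"
proof -
  obtain x a b where e: "e = (x, a, b)"
    by (cases e)
  then have N: "N x = {a, b}"
    using assms by (auto simp: agrees_def)
  have "a \<noteq> b"
    using out[of x] N by auto
  moreover have "x \<noteq> a" "x \<noteq> b"
    using two_geodetic_irrefl[OF geo, of x] N by auto
  moreover have "\<forall>y\<in>{a, b}. x \<notin> N y \<and> {a, b} \<inter> N y = {} \<and> (\<forall>z\<in>{a, b}. y \<noteq> z \<longrightarrow> N y \<inter> N z = {})"
    using geo N unfolding two_geodetic_def by metis
  ultimately show ?thesis
    using known_nbhd[OF assms(1), of a] known_nbhd[OF assms(1), of b]
    by (auto simp: known_tree_def e)
qed

text \<open>Two earlier entries containing \<open>y\<close> have distinct sources, both different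
  from \<open>x\<close>; with \<open>x\<close> itself, \<open>y\<close> would have three
  in-neighbours.\<close>

lemma not_saturated:
  assumes "agrees N es" "distinct (map fst es)" "x \<notin> fst ` set es" "y \<in> N x"
  shows "\<not> saturated es y"
proof -
  define fs where "fs = filter (\<lambda>(x, a, b). a = y \<or> b = y) es"
  have "insert x (fst ` set fs) \<subseteq> {x. y \<in> N x}"
    using assms(1,4) by (fastforce simp: fs_def agrees_def)
  then have "card (insert x (fst ` set fs)) \<le> 2"
    using in_nbhd[of y] card_mono[of "{x. y \<in> N x}"] by (meson finite_code le_trans)
  moreover have "x \<notin> fst ` set fs"
    using assms(3) by (auto simp: fs_def)
  moreover have "distinct (map fst fs)"
    using assms(2) unfolding fs_def by (rule distinct_map_filter)
  then have "card (fst ` set fs) = length fs"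
    by (metis distinct_card length_map set_map)
  ultimately show ?thesis
    by (simp add: saturated_def fs_def)
qed

text \<open>\<open>search\<close> asserts that every surviving branch ends in a classified leaf. The
  branch that follows \<open>N\<close> is never pruned, so its leaf classifies
  \<open>N\<close>.\<close>

lemma search_sound:
  assumes "search xs es" "agrees N es" "distinct (xs @ map fst es)"
  shows "relabels N N1 \<or> relabels N N2"
  using assms
proof (induction xs arbitrary: es)
  case Nil
  then show ?case
    by (simp add: classified_imp_relabels)
next
  case (Cons x xs)
  obtain a b where ab: "N x = {a, b}" "a \<noteq> b"
    using out[of x] by (auto simp: card_2_iff)
  have free: "y \<in> set (filter (\<lambda>y. \<not> saturated es y) all_vertices)" if "y \<in> N x" for y
    using not_saturated[OF Cons.prems(2) _ _ that] Cons.prems(3) UNIV_vertex by auto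
  then obtain c d where cd: "(c, d) \<in> set (pairs (filter (\<lambda>y. \<not> saturated es y) all_vertices))" "N x = {c, d}"
    using pairs_cover[OF free free ab(2)] ab by auto
  have agrees: "agrees N ((x, c, d) # es)"
    using Cons.prems(2) cd(2) by (simp add: agrees_def)
  then have "admissible ((x, c, d) # es) x"
    using distinct_known_tree[OF agrees] by (auto simp: admissible_def list_all_iff)
  then have "search xs ((x, c, d) # es)"
    using Cons.prems(1) cd(1) by (auto simp: list_all_iff Let_def dest: bspec)
  then show ?case
    by (rule Cons.IH) (use agrees Cons.prems(3) in simp_all)
qed

end

text \<open>The open labels are the four leaves of the tree at \<open>U\<close> and the two vertices
  \<open>V\<close>, \<open>V4\<close> outside it. Taking \<open>V1\<close> and \<open>U4\<close>
  first completes the tree at \<open>U1\<close>.\<close>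

lemma search_succeeds: "search [V1, U4, V, V4, U5, U6] [(U, U1, U2), (U1, V1, U4), (U2, U5, U6)]"
  by code_simp

section \<open>The classification\<close>

lemma bij_case_vertex:
  assumes "distinct [u, u1, u2, u4, u5, u6, v, v1, v4]"
  shows "bij_betw (case_vertex u u1 u2 u4 u5 u6 v v1 v4) UNIV {u, u1, u2, u4, u5, u6, v, v1, v4}"
proof (rule bij_betw_imageI)
  show "inj (case_vertex u u1 u2 u4 u5 u6 v v1 v4)"
  proof (rule injI)
    fix x y
    assume "case_vertex u u1 u2 u4 u5 u6 v v1 v4 x = case_vertex u u1 u2 u4 u5 u6 v v1 v4 y"
    then show "x = y"
      using assms by (cases x; cases y) auto
  qed
  show "range (case_vertex u u1 u2 u4 u5 u6 v v1 v4) = {u, u1, u2, u4, u5, u6, v, v1, v4}"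
    by (auto simp: UNIV_vertex all_vertices_def)
qed

lemma diregular_excess_classification:
  assumes "excess_digraph 2 2 2 G" "diregular 2 G"
  shows "digraph_iso G D1 \<or> digraph_iso G D2"
proof -
  interpret fin_digraph G
    using assms(1) by (simp add: excess_digraph_def)
  have card_verts: "card (verts G) = 9"
    using assms(1) by (simp add: excess_digraph_def moore_bound_def numeral_2_eq_2)
  have inj: "inj_on (arc_to_ends G) (arcs G)" and geo: "two_geodetic (out_nbhd G)"
    using assms(1) k_geodetic_2_imp by (simp_all add: excess_digraph_def)
  have out: "card (out_nbhd G x) = 2" and in_nbhd: "card {y. x \<in> out_nbhd G y} = 2" if "x \<in> verts G" for x
    using assms(2) that
    by (simp_all add: diregular_def out_degree_eq_card_out_nbhd[OF inj] in_degree_eq_card_in_nbhd[OF inj])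
  have sub: "out_nbhd G x \<subseteq> verts G" for x
    by (auto simp: out_nbhd_def dest: adj_in_verts)
  have two: "\<exists>a b. out_nbhd G x = {a, b} \<and> a \<noteq> b \<and> a \<in> verts G \<and> b \<in> verts G" if "x \<in> verts G" for x
    using out[OF that] sub[of x] by (auto simp: card_2_iff)
  obtain u where u: "u \<in> verts G"
    using card_verts by (metis card.empty ex_in_conv zero_neq_numeral)
  obtain u1 u2 where N_u: "out_nbhd G u = {u1, u2}" "u1 \<noteq> u2" "u1 \<in> verts G" "u2 \<in> verts G"
    using two[OF u] by blast
  \<comment> \<open>The names follow the initial entries of the search, which are those of
    \<open>D1\<close>; for \<open>D2\<close> the matching is left to \<open>embeds\<close>.\<close>
  obtain v1 u4 where N_u1: "out_nbhd G u1 = {v1, u4}" "v1 \<noteq> u4" "v1 \<in> verts G" "u4 \<in> verts G"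
    using two[OF N_u(3)] by blast
  obtain u5 u6 where N_u2: "out_nbhd G u2 = {u5, u6}" "u5 \<noteq> u6" "u5 \<in> verts G" "u6 \<in> verts G"
    using two[OF N_u(4)] by blast
  have irrefl: "x \<notin> out_nbhd G x" for x
    using geo by (rule two_geodetic_irrefl)
  have tree: "\<forall>y\<in>{u1, u2}. u \<notin> out_nbhd G y \<and> {u1, u2} \<inter> out_nbhd G y = {} \<and>
      (\<forall>z\<in>{u1, u2}. y \<noteq> z \<longrightarrow> out_nbhd G y \<inter> out_nbhd G z = {})"
    using geo N_u(1) unfolding two_geodetic_def by metis
  have dist: "distinct [u, u1, u2, u4, u5, u6, v1]"
    using tree irrefl[of u] N_u N_u1 N_u2 by auto
  define T where "T = {u, u1, u2, u4, u5, u6, v1}"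
  have T: "T \<subseteq> verts G" "card T = 7"
    using u N_u N_u1 N_u2 distinct_card[OF dist] by (simp_all add: T_def)
  then have "card (verts G - T) = 2"
    using card_verts by (simp add: card_Diff_subset T_def)
  then obtain v v4 where v: "verts G - T = {v, v4}" "v \<noteq> v4"
    by (auto simp: card_2_iff)
  define \<psi> where "\<psi> = case_vertex u u1 u2 u4 u5 u6 v v1 v4"
  have "verts G = T \<union> {v, v4}"
    using v T by blast
  also have "\<dots> = {u, u1, u2, u4, u5, u6, v, v1, v4}"
    by (auto simp: T_def)
  finally have verts: "verts G = {u, u1, u2, u4, u5, u6, v, v1, v4}" .
  have "v \<notin> T" "v4 \<notin> T"
    using v by blast+
  then have "distinct [u, u1, u2, u4, u5, u6, v, v1, v4]"
    using dist v(2) by (auto simp: T_def)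
  then have \<psi>: "bij_betw \<psi> UNIV (verts G)"
    unfolding \<psi>_def verts by (rule bij_case_vertex)
  then have inj_\<psi>: "inj \<psi>" and range_\<psi>: "range \<psi> = verts G"
    by (auto simp: bij_betw_def)
  \<comment> \<open>The digraph \<open>G\<close> carried over to the nine labels.\<close>
  define N where "N x = \<psi> -` out_nbhd G (\<psi> x)" for x
  have \<psi>_N: "\<psi> ` N x = out_nbhd G (\<psi> x)" for x
    using sub range_\<psi> by (force simp: N_def)
  interpret two_geodetic_labelling N
  proof
    show "two_geodetic N"
      unfolding N_def using inj_\<psi> geo by (rule two_geodetic_vimage)
    show "card (N x) = 2" for x
      using card_image[of \<psi> "N x"] inj_\<psi> \<psi>_N[of x] out[of "\<psi> x"] range_\<psi>
      by (metis inj_on_subset rangeI subset_UNIV)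
    show "card {x. y \<in> N x} \<le> 2" for y
    proof -
      have "\<psi> ` {x. y \<in> N x} \<subseteq> {z. \<psi> y \<in> out_nbhd G z}"
        by (auto simp: N_def)
      moreover have "card {z. \<psi> y \<in> out_nbhd G z} = 2"
        using in_nbhd range_\<psi> by blast
      ultimately have "card (\<psi> ` {x. y \<in> N x}) \<le> 2"
        \<comment> \<open>Infinite sets have cardinality 0, so cardinality 2 supplies the finiteness
          for \<open>card_mono\<close>.\<close>
        by (metis card.infinite card_mono zero_neq_numeral)
      then show ?thesis
        using card_image[of \<psi> "{x. y \<in> N x}"] inj_\<psi> by (metis inj_on_subset subset_UNIV)
    qed
  qed
  have "\<psi> ` N U = \<psi> ` {U1, U2}" "\<psi> ` N U1 = \<psi> ` {V1, U4}" "\<psi> ` N U2 = \<psi> ` {U5, U6}"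
    unfolding \<psi>_N by (simp_all add: \<psi>_def N_u N_u1 N_u2)
  then have "agrees N [(U, U1, U2), (U1, V1, U4), (U2, U5, U6)]"
    unfolding inj_image_eq_iff[OF inj_\<psi>] by (simp add: agrees_def)
  then have "relabels N N1 \<or> relabels N N2"
    by (rule search_sound[OF search_succeeds]) simp
  moreover have "digraph_iso G (digraph_of_nbhds M)" if M: "relabels N M" for M
  proof -
    obtain f where f: "bij f" "\<And>x. N (f x) = f ` M x"
      using M by (auto simp: relabels_def)
    show ?thesis
    proof (rule digraph_iso_digraph_of_nbhdsI[OF inj])
      \<comment> \<open>Relabelling by \<open>f\<close> and then naming by \<open>\<psi>\<close>
        identifies the labels of \<open>M\<close> with the vertices of \<open>G\<close>.\<close>
      show "bij_betw (\<psi> \<circ> f) UNIV (verts G)"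
        using f(1) \<psi> by (rule bij_betw_trans)
      show "(\<psi> \<circ> f) y \<in> out_nbhd G ((\<psi> \<circ> f) x) \<longleftrightarrow> y \<in> M x" for x y
        using f(2)[of x] inj_image_mem_iff[OF bij_is_inj[OF f(1)]] by (auto simp: N_def)
    qed
  qed
  ultimately show ?thesis
    by (auto simp: D1_def D2_def)
qed

theorem theorem1:
  shows "excess_digraph 2 2 2 D1 \<and> diregular 2 D1
    \<and> excess_digraph 2 2 2 D2 \<and> diregular 2 D2
    \<and> \<not> digraph_iso D1 D2
    \<and> (\<forall>G :: ('a, 'b) pre_digraph.
         excess_digraph 2 2 2 G \<and> diregular 2 G \<longrightarrow> digraph_iso G D1 \<or> digraph_iso G D2)"
  using D1_diregular_excess D2_diregular_excess D1_not_iso_D2 diregular_excess_classification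
  by blast

end
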